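(* Let $G$ and $H$ be connected graphs with roots $R_G\subseteq G$ and $R_H\subseteq H$, and let $d_{R_G}=d(R_G,Res(G,R_G))$, $d_{R_H}=d(R_H,Res(H,R_H))$. Then \[Res(G\boxtimes H,\;R_G\boxtimes R_H)\cong\begin{cases} H\boxtimes Res(G,R_G), & \text{if } d_{R_G}>d_{R_H};\\ G\boxtimes Res(H,R_H), & \text{if } d_{R_G}<d_{R_H};\\ \left\langle V(Res(G,R_G))\times V(H)\;\cup\;V(G)\times V(Res(H,R_H))\right\rangle, & \text{if } d_{R_G}=d_{R_H},\end{cases}\] where in the last case the induced subgraph is taken in $G\boxtimes H$.
   Context: A root of a connected finite graph $G$ is an induced subgraph $R_G=\langle V_0\rangle$ on a nonempty vertex set $V_0$; with $V_i$ the set of vertices at distance exactly $i$ from $V_0$ and $r$ the largest $i$ with $V_i\ne\emptyset$, the distance-residual graph is $Res(G,R_G)=\langle V_r\rangle$, and $d_{R_G}=d(R_G,Res(G,R_G))=r$ (distance between subgraphs is the minimum distance between their vertices). $G\boxtimes H$ is the strong product: vertex set $V(G)\times V(H)$, with $(u,x)\sim(v,y)$ iff ($u=v$ and $xy\in E(H)$), or ($x=y$ and $uv\in E(G)$), or ($uv\in E(G)$ and $xy\in E(H)$). $R_G\boxtimes R_H$ is the subgraph induced on $V(R_G)\times V(R_H)$. *)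

theory Defs
  imports
    "Graph_Theory.Pair_Digraph"
    "Graph_Theory.Digraph_Component"
    "Graph_Theory.Digraph_Isomorphism"
    "Graph_Theory.Shortest_Path"
    "HOL-Library.Extended_Nat"
begin

text \<open>
  A finite simple graph is a \<^locale>\<open>pair_graph\<close>: an edge \<open>uv\<close> is the pair of arcs
  \<open>(u,v)\<close>, \<open>(v,u)\<close>.
\<close>

abbreviation graph_iso :: "'a pair_pre_digraph \<Rightarrow> 'b pair_pre_digraph \<Rightarrow> bool"
    (infix \<open>\<cong>\<^sub>g\<close> 50) where
  "A \<cong>\<^sub>g B \<equiv> digraph_iso (with_proj A) (with_proj B)"

definition induced :: "'a pair_pre_digraph \<Rightarrow> 'a set \<Rightarrow> 'a pair_pre_digraph" where
  "induced G S = \<lparr> pverts = S, parcs = {e \<in> parcs G. fst e \<in> S \<and> snd e \<in> S} \<rparr>"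

lemma with_proj_induced: "with_proj (induced G S) = with_proj G \<restriction> S"
  by (simp add: with_proj_def induced_def induce_subgraph_def)

definition is_root :: "'a pair_pre_digraph \<Rightarrow> 'a pair_pre_digraph \<Rightarrow> bool" where
  "is_root R G \<longleftrightarrow> (\<exists>S. S \<noteq> {} \<and> S \<subseteq> pverts G \<and> R = induced G S)"

definition gdist :: "'a pair_pre_digraph \<Rightarrow> 'a \<Rightarrow> 'a \<Rightarrow> enat" where
  "gdist G u v = (INF p \<in> {p. pre_digraph.awalk (with_proj G) u p v}. enat (length p))"

definition set_dist :: "'a pair_pre_digraph \<Rightarrow> 'a set \<Rightarrow> 'a set \<Rightarrow> enat" where
  "set_dist G S T = (INF u \<in> S. INF v \<in> T. gdist G u v)"

definition subgraph_dist ::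
    "'a pair_pre_digraph \<Rightarrow> 'a pair_pre_digraph \<Rightarrow> 'a pair_pre_digraph \<Rightarrow> enat" where
  "subgraph_dist G A B = set_dist G (pverts A) (pverts B)"

definition level :: "'a pair_pre_digraph \<Rightarrow> 'a pair_pre_digraph \<Rightarrow> nat \<Rightarrow> 'a set" where
  "level G R i = {v \<in> pverts G. set_dist G (pverts R) {v} = enat i}"

definition Res :: "'a pair_pre_digraph \<Rightarrow> 'a pair_pre_digraph \<Rightarrow> 'a pair_pre_digraph" where
  "Res G R = induced G (level G R (GREATEST i. level G R i \<noteq> {}))"

definition root_dist :: "'a pair_pre_digraph \<Rightarrow> 'a pair_pre_digraph \<Rightarrow> enat" where
  "root_dist G R = subgraph_dist G R (Res G R)"

definition strong_prod ::
    "'a pair_pre_digraph \<Rightarrow> 'b pair_pre_digraph \<Rightarrow> ('a \<times> 'b) pair_pre_digraph"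
    (infixl \<open>\<boxtimes>\<close> 70) where
  "G \<boxtimes> H = \<lparr> pverts = pverts G \<times> pverts H,
     parcs = {((u, x), (v, y)) | u x v y.
       u \<in> pverts G \<and> u = v \<and> (x, y) \<in> parcs H \<or>
       x \<in> pverts H \<and> x = y \<and> (u, v) \<in> parcs G \<or>
       (u, v) \<in> parcs G \<and> (x, y) \<in> parcs H} \<rparr>"

text \<open>
  The product of two roots is the subgraph of the product induced on the product of
  their vertex sets.
\<close>

lemma strong_prod_roots:
  assumes "is_root R G" "is_root S H"
  shows "R \<boxtimes> S = induced (G \<boxtimes> H) (pverts R \<times> pverts S)"
  using assms by (auto simp: is_root_def induced_def strong_prod_def)

lemma is_root_strong_prod:
  assumes "is_root R G" "is_root S H"
  shows "is_root (R \<boxtimes> S) (G \<boxtimes> H)"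
  unfolding is_root_def strong_prod_roots[OF assms]
  using assms by (intro exI[of _ "pverts R \<times> pverts S"])
    (auto simp: is_root_def induced_def strong_prod_def)

text \<open>The distance is the library's shortest-path distance for unit weights.\<close>

lemma gdist_eq_mu:
  assumes "pair_wf_digraph G"
  shows "ereal_of_enat (gdist G u v) = wf_digraph.\<mu> (with_proj G) (\<lambda>_. 1) u v"
proof -
  interpret pair_wf_digraph G by fact
  have cost: "awalk_cost (\<lambda>_. 1) p = real (length p)" for p :: "('a \<times> 'a) list"
    by (induction p) auto
  show ?thesis
  proof (cases "{p. awalk u p v} = {}")
    case True
    then show ?thesis
      by (simp add: gdist_def \<mu>_def top_enat_def top_ereal_def)
  next
    case False
    then obtain p where p: "awalk u p v" "\<And>q. awalk u q v \<Longrightarrow> length p \<le> length q"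
      using ex_has_least_nat[of "\<lambda>p. awalk u p v" _ length] by blast
    have "gdist G u v = enat (length p)"
      unfolding gdist_def using p by (intro antisym INF_lower2[of p] INF_greatest) auto
    moreover have "\<mu> (\<lambda>_. 1) u v = ereal (real (length p))"
      unfolding \<mu>_def cost using p by (intro antisym INF_lower2[of p] INF_greatest) auto
    ultimately show ?thesis
      by simp
  qed
qed

end

theory Submission
  imports Defs
begin

text \<open>
  In a strong product the closed neighbourhood of a vertex is the product of the closed
  neighbourhoods of its coordinates. Hence the ball of radius \<open>n\<close> around \<open>S \<times> T\<close> is the product
  of the balls of radius \<open>n\<close> around \<open>S\<close> and \<open>T\<close>, so distances from \<open>S \<times> T\<close> are maxima of
  coordinate distances, and the farthest level can be read off.
\<close>

section \<open>Balls around a vertex set\<close>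

text \<open>A strict upper bound on an infimum in a complete linear order is witnessed by an
  element, and a finite weak bound in \<open>enat\<close> is the strict bound by the successor.
  Finiteness matters: for empty \<open>A\<close> the infimum is \<open>\<infinity>\<close> without a
  witness.\<close>

lemma Inf_enat_le_iff: "Inf A \<le> enat n \<longleftrightarrow> (\<exists>x\<in>A. x \<le> enat n)"
proof -
  have less: "x \<le> enat n \<longleftrightarrow> x < enat (Suc n)" for x
    by (cases x) auto
  show ?thesis
    by (simp add: less Inf_less_iff)
qed

lemma set_dist_le_iff:
  "set_dist G S {v} \<le> enat n \<longleftrightarrow>
    (\<exists>u\<in>S. \<exists>p. pre_digraph.awalk (with_proj G) u p v \<and> length p \<le> n)"
  by (auto simp: set_dist_def gdist_def Inf_enat_le_iff)

text \<open>Only the empty walk has length 0, and it is a walk only at a vertex, which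
  \<open>S \<subseteq> pverts G\<close> guarantees.\<close>

lemma set_dist_le_0_iff:
  assumes "S \<subseteq> pverts G"
  shows "set_dist G S {v} \<le> enat 0 \<longleftrightarrow> v \<in> S"
  using assms by (auto simp: set_dist_le_iff pre_digraph.awalk_def pre_digraph.cas.simps)

text \<open>Cut off or append the last arc of a walk. The alternative \<open>w = v\<close> makes
  each ball the closed neighbourhood of the previous one, the form that factors in a strong
  product.\<close>

lemma set_dist_le_Suc_iff:
  assumes "pair_wf_digraph G"
  shows "set_dist G S {v} \<le> enat (Suc n) \<longleftrightarrow>
    (\<exists>w. set_dist G S {w} \<le> enat n \<and> (w = v \<or> (w, v) \<in> parcs G))"
proof -
  interpret pair_wf_digraph G by fact
  show ?thesis
  proof
    assume "set_dist G S {v} \<le> enat (Suc n)"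
    then obtain u p where up: "u \<in> S" "awalk u p v" "length p \<le> Suc n"
      by (auto simp: set_dist_le_iff)
    show "\<exists>w. set_dist G S {w} \<le> enat n \<and> (w = v \<or> (w, v) \<in> parcs G)"
    proof (cases p rule: rev_cases)
      case Nil
      then show ?thesis
        using up by (intro exI[of _ v]) (force simp: set_dist_le_iff)
    next
      case (snoc q e)
      then have "awalk u q (fst e)" "e \<in> parcs G" "snd e = v"
        using up(2) by (auto simp: awalk_simps)
      then show ?thesis
        using up snoc by (intro exI[of _ "fst e"]) (auto simp: set_dist_le_iff)
    qed
  next
    assume "\<exists>w. set_dist G S {w} \<le> enat n \<and> (w = v \<or> (w, v) \<in> parcs G)"
    then obtain u p w where up: "u \<in> S" "awalk u p w" "length p \<le> n"
      and w: "w = v \<or> (w, v) \<in> parcs G"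
      by (auto simp: set_dist_le_iff)
    show "set_dist G S {v} \<le> enat (Suc n)"
    proof (cases "w = v")
      case True
      then show ?thesis
        using up by (auto simp: set_dist_le_iff intro: le_SucI)
    next
      case False
      then have "awalk u (p @ [(w, v)]) v"
        using up w by (auto simp: awalk_simps arc_implies_awalk in_arcsD1 in_arcsD2)
      then show ?thesis
        using up unfolding set_dist_le_iff
        by (intro bexI[of _ u] exI[of _ "p @ [(w, v)]"]) auto
    qed
  qed
qed

section \<open>Distances in a strong product\<close>

lemma pair_wf_digraph_strong_prod:
  assumes "pair_wf_digraph G" "pair_wf_digraph H"
  shows "pair_wf_digraph (G \<boxtimes> H)"
  using assms by (fastforce simp: pair_wf_digraph_def strong_prod_def)

text \<open>Induction on the radius, with \<open>v\<close> and \<open>y\<close> arbitrary because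
  the hypothesis is applied at their neighbours.\<close>

lemma set_dist_strong_prod_le_iff:
  assumes G: "pair_wf_digraph G" and H: "pair_wf_digraph H"
    and S: "S \<subseteq> pverts G" and T: "T \<subseteq> pverts H"
    and "v \<in> pverts G" "y \<in> pverts H"
  shows "set_dist (G \<boxtimes> H) (S \<times> T) {(v, y)} \<le> enat n \<longleftrightarrow>
    set_dist G S {v} \<le> enat n \<and> set_dist H T {y} \<le> enat n"
  using assms(5,6)
proof (induction n arbitrary: v y)
  case 0
  have "S \<times> T \<subseteq> pverts (G \<boxtimes> H)"
    using S T by (auto simp: strong_prod_def)
  then show ?case
    using S T by (simp add: set_dist_le_0_iff)
next
  case (Suc n)
  have parcs_in_G: "u \<in> pverts G" "v \<in> pverts G" if "(u, v) \<in> parcs G" for u v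
    using that G by (auto simp: pair_wf_digraph_def)
  have parcs_in_H: "u \<in> pverts H" "v \<in> pverts H" if "(u, v) \<in> parcs H" for u v
    using that H by (auto simp: pair_wf_digraph_def)
  \<comment> \<open>The vertex conditions in the arcs of \<open>\<boxtimes>\<close> concern only a
    coordinate that stays fixed, so they follow from \<open>v\<close> and \<open>y\<close> being
    vertices.\<close>
  have nbhd: "((u, x) = (v, y) \<or> ((u, x), (v, y)) \<in> parcs (G \<boxtimes> H)) \<longleftrightarrow>
      (u = v \<or> (u, v) \<in> parcs G) \<and> (x = y \<or> (x, y) \<in> parcs H)" for u x
    using Suc.prems by (auto simp: strong_prod_def)
  have nbhd_in: "u \<in> pverts G" "x \<in> pverts H"
    if "u = v \<or> (u, v) \<in> parcs G" "x = y \<or> (x, y) \<in> parcs H" for u x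
    using that Suc.prems parcs_in_G parcs_in_H by blast+
  have "set_dist (G \<boxtimes> H) (S \<times> T) {(v, y)} \<le> enat (Suc n) \<longleftrightarrow>
      (\<exists>u x. set_dist (G \<boxtimes> H) (S \<times> T) {(u, x)} \<le> enat n \<and>
        (u = v \<or> (u, v) \<in> parcs G) \<and> (x = y \<or> (x, y) \<in> parcs H))"
    by (simp only: set_dist_le_Suc_iff[OF pair_wf_digraph_strong_prod[OF G H]]
        split_paired_Ex nbhd)
  also have "\<dots> \<longleftrightarrow> (\<exists>u x. (set_dist G S {u} \<le> enat n \<and> set_dist H T {x} \<le> enat n) \<and>
        (u = v \<or> (u, v) \<in> parcs G) \<and> (x = y \<or> (x, y) \<in> parcs H))"
    using Suc.IH nbhd_in by metis
  \<comment> \<open>The conditions on \<open>u\<close> and on \<open>x\<close> are independent, so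
    the joint existential splits into one for each factor.\<close>
  also have "\<dots> \<longleftrightarrow> set_dist G S {v} \<le> enat (Suc n) \<and> set_dist H T {y} \<le> enat (Suc n)"
    unfolding set_dist_le_Suc_iff[OF G] set_dist_le_Suc_iff[OF H] by blast
  finally show ?case .
qed

text \<open>Elements of \<open>enat\<close> with the same finite upper bounds are equal, and a
  maximum is bounded exactly when both arguments are.\<close>

lemma set_dist_strong_prod:
  assumes "pair_wf_digraph G" "pair_wf_digraph H" "S \<subseteq> pverts G" "T \<subseteq> pverts H"
    and "v \<in> pverts G" "y \<in> pverts H"
  shows "set_dist (G \<boxtimes> H) (S \<times> T) {(v, y)} = max (set_dist G S {v}) (set_dist H T {y})"
proof -
  have enat_eqI: "a = b" if "\<And>n. a \<le> enat n \<longleftrightarrow> b \<le> enat n" for a b :: enat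
    using that by (metis enat_ord_code(3) not_enat_eq order_antisym order_refl)
  show ?thesis
    by (rule enat_eqI) (simp add: set_dist_strong_prod_le_iff[OF assms])
qed

section \<open>Eccentricity of a root\<close>

text \<open>Arcs come in symmetric pairs, so connectedness yields a directed walk from any chosen
  vertex of \<open>S\<close> to \<open>v\<close>.\<close>

lemma set_dist_finite:
  assumes "pair_graph G" "Digraph_Component.connected (with_proj G)"
    and "S \<noteq> {}" "S \<subseteq> pverts G" "v \<in> pverts G"
  shows "set_dist G S {v} \<noteq> \<infinity>"
proof -
  interpret pair_graph G by fact
  obtain u where "u \<in> S"
    using assms by blast
  then have "u \<rightarrow>\<^sup>*\<^bsub>with_proj G\<^esub> v"
    using symmetric_connected_imp_strongly_connected[OF pair_sym_arcs assms(2)] assms(4,5)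
    by (auto simp: strongly_connected_def)
  then obtain p where "awalk u p v"
    by (auto simp: reachable_awalk)
  then have "set_dist G S {v} \<le> enat (length p)"
    using \<open>u \<in> S\<close> by (auto simp: set_dist_le_iff)
  then show ?thesis
    by (cases "set_dist G S {v}") auto
qed

text \<open>The assumptions say that \<open>r\<close> is attained and never exceeded; later lemmas
  describe the farthest level by this pair of facts.\<close>

lemma Greatest_level_eq:
  assumes "level G R r \<noteq> {}" "\<And>v. v \<in> pverts G \<Longrightarrow> set_dist G (pverts R) {v} \<le> enat r"
  shows "(GREATEST i. level G R i \<noteq> {}) = r"
  using assms by (intro Greatest_equality) (auto simp: level_def, fastforce)

text \<open>The distance attains its maximum on the finite nonempty vertex set, and connectedness
  makes that maximum a natural number.\<close>

lemma ex_eccentricity: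
  assumes "pair_graph G" "Digraph_Component.connected (with_proj G)" "is_root R G"
  obtains r where "level G R r \<noteq> {}"
    and "\<And>v. v \<in> pverts G \<Longrightarrow> set_dist G (pverts R) {v} \<le> enat r"
proof -
  let ?d = "\<lambda>v. set_dist G (pverts R) {v}"
  have R: "pverts R \<noteq> {}" "pverts R \<subseteq> pverts G"
    using assms(3) by (auto simp: is_root_def induced_def)
  have "finite (pverts G)"
    using assms(1) by (simp add: pair_graph_def pair_digraph_def pair_fin_digraph.pair_finite_verts)
  moreover have "pverts G \<noteq> {}"
    using R by blast
  ultimately obtain v where v: "v \<in> pverts G" "\<And>w. w \<in> pverts G \<Longrightarrow> ?d w \<le> ?d v"
    using Max_in[of "?d ` pverts G"] Max_ge[of "?d ` pverts G"] by fastforce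
  obtain r where "?d v = enat r"
    using set_dist_finite[OF assms(1,2) R v(1)] by auto
  then show ?thesis
    using v by (intro that[of r]) (auto simp: level_def)
qed

lemma root_dist_eq:
  assumes "level G R r \<noteq> {}" "\<And>v. v \<in> pverts G \<Longrightarrow> set_dist G (pverts R) {v} \<le> enat r"
  shows "root_dist G R = enat r"
proof -
  have "root_dist G R = set_dist G (pverts R) (level G R r)"
    by (simp add: root_dist_def subgraph_dist_def Res_def Greatest_level_eq[OF assms] induced_def)
  \<comment> \<open>Swapping the two infima leaves the distance from the root to each vertex of the
    farthest level, which is constantly \<open>r\<close>.\<close>
  also have "\<dots> = (INF v \<in> level G R r. set_dist G (pverts R) {v})"
    unfolding set_dist_def by (subst INF_commute) simp
  also have "\<dots> = (INF v \<in> level G R r. enat r)"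
    by (intro INF_cong) (auto simp: level_def)
  finally show ?thesis
    using assms(1) by simp
qed

section \<open>The farthest level of the product\<close>

text \<open>Distances in the product are maxima of coordinate distances, so none exceeds
  \<open>max r s\<close>, and a pair of farthest vertices attains it.\<close>

lemma Res_strong_prod:
  assumes G: "pair_wf_digraph G" and H: "pair_wf_digraph H"
    and R: "is_root R G" and Q: "is_root Q H"
    and r: "level G R r \<noteq> {}" "\<And>v. v \<in> pverts G \<Longrightarrow> set_dist G (pverts R) {v} \<le> enat r"
    and s: "level H Q s \<noteq> {}" "\<And>y. y \<in> pverts H \<Longrightarrow> set_dist H (pverts Q) {y} \<le> enat s"
  shows "Res (G \<boxtimes> H) (R \<boxtimes> Q) = induced (G \<boxtimes> H)
    {(v, y) \<in> pverts G \<times> pverts H.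
      max (set_dist G (pverts R) {v}) (set_dist H (pverts Q) {y}) = enat (max r s)}"
    (is "_ = induced _ ?L")
proof -
  have sub: "pverts R \<subseteq> pverts G" "pverts Q \<subseteq> pverts H"
    using R Q by (auto simp: is_root_def induced_def)
  have verts: "pverts (G \<boxtimes> H) = pverts G \<times> pverts H"
    "pverts (R \<boxtimes> Q) = pverts R \<times> pverts Q"
    by (simp_all add: strong_prod_def)
  have L: "level (G \<boxtimes> H) (R \<boxtimes> Q) (max r s) = ?L"
    using set_dist_strong_prod[OF G H sub] by (auto simp: level_def verts)
  have "(GREATEST i. level (G \<boxtimes> H) (R \<boxtimes> Q) i \<noteq> {}) = max r s"
  proof (rule Greatest_level_eq)
    show "level (G \<boxtimes> H) (R \<boxtimes> Q) (max r s) \<noteq> {}"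
      using r(1) s(1) unfolding L by (fastforce simp: level_def)
    show "set_dist (G \<boxtimes> H) (pverts (R \<boxtimes> Q)) {v} \<le> enat (max r s)"
      if "v \<in> pverts (G \<boxtimes> H)" for v
      using that max.mono[OF r(2) s(2)] set_dist_strong_prod[OF G H sub]
      by (auto simp: verts)
  qed
  then show ?thesis
    by (simp add: Res_def L)
qed

section \<open>Induced factors and isomorphisms\<close>

text \<open>Arcs of \<open>H\<close> end in \<open>pverts H\<close>, so inducing on all of
  \<open>pverts H\<close> in the second coordinate loses no arc.\<close>

lemma strong_prod_induced_left:
  assumes "pair_wf_digraph H"
  shows "S \<subseteq> pverts G \<Longrightarrow> induced G S \<boxtimes> H = induced (G \<boxtimes> H) (S \<times> pverts H)"
  using assms by (fastforce simp: pair_wf_digraph_def induced_def strong_prod_def)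

lemma strong_prod_induced_right:
  assumes "pair_wf_digraph G"
  shows "T \<subseteq> pverts H \<Longrightarrow> G \<boxtimes> induced H T = induced (G \<boxtimes> H) (pverts G \<times> T)"
  using assms by (fastforce simp: pair_wf_digraph_def induced_def strong_prod_def)

text \<open>Swapping coordinates is the isomorphism. It is needed for the case whose right-hand side
  has \<open>H\<close> as the first factor.\<close>

lemma strong_prod_commute:
  assumes "pair_wf_digraph G" "pair_wf_digraph H"
  shows "G \<boxtimes> H \<cong>\<^sub>g H \<boxtimes> G"
proof -
  let ?f = "\<lparr>iso_verts = prod.swap, iso_arcs = map_prod prod.swap prod.swap,
    iso_head = snd, iso_tail = fst\<rparr>"
  interpret pair_wf_digraph "G \<boxtimes> H"
    using assms by (rule pair_wf_digraph_strong_prod)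
  have "pre_digraph.digraph_isomorphism (with_proj (G \<boxtimes> H)) ?f"
    using wf_digraph_axioms
    by (auto simp: pre_digraph.digraph_isomorphism_def inj_on_def)
  moreover have "with_proj (H \<boxtimes> G) = app_iso ?f (with_proj (G \<boxtimes> H))"
    by (auto simp: with_proj_def app_iso_def strong_prod_def image_iff)
  ultimately show ?thesis
    unfolding digraph_iso_def by blast
qed

text \<open>The isomorphism record also supplies the head and tail maps of the image, so the
  identity must carry those of \<open>G\<close>.\<close>

lemma digraph_iso_refl:
  assumes "wf_digraph G"
  shows "digraph_iso G G"
  unfolding digraph_iso_def
  using assms
  by (intro exI[of _ "\<lparr>iso_verts = id, iso_arcs = id, iso_head = head G, iso_tail = tail G\<rparr>"])
    (simp add: pre_digraph.digraph_isomorphism_def app_iso_def)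

lemma pair_wf_digraph_induced:
  assumes "pair_wf_digraph G"
  shows "pair_wf_digraph (induced G S)"
  using assms by (auto simp: pair_wf_digraph_def induced_def)

lemma graph_iso_refl:
  assumes "pair_wf_digraph G"
  shows "G \<cong>\<^sub>g G"
proof -
  interpret pair_wf_digraph G by fact
  show ?thesis
    using wf_digraph_axioms by (rule digraph_iso_refl)
qed

theorem theorem4:
  fixes G R\<^sub>G :: "'a pair_pre_digraph"
    and H R\<^sub>H :: "'b pair_pre_digraph"
  assumes "pair_graph G" and "Digraph_Component.connected (with_proj G)"
    and "pair_graph H" and "Digraph_Component.connected (with_proj H)"
    and "is_root R\<^sub>G G" and "is_root R\<^sub>H H"
  shows
    "(root_dist G R\<^sub>G > root_dist H R\<^sub>H \<longrightarrow>
        Res (G \<boxtimes> H) (R\<^sub>G \<boxtimes> R\<^sub>H) \<cong>\<^sub>g H \<boxtimes> Res G R\<^sub>G) \<and>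
     (root_dist G R\<^sub>G < root_dist H R\<^sub>H \<longrightarrow>
        Res (G \<boxtimes> H) (R\<^sub>G \<boxtimes> R\<^sub>H) \<cong>\<^sub>g G \<boxtimes> Res H R\<^sub>H) \<and>
     (root_dist G R\<^sub>G = root_dist H R\<^sub>H \<longrightarrow>
        Res (G \<boxtimes> H) (R\<^sub>G \<boxtimes> R\<^sub>H) \<cong>\<^sub>g
          induced (G \<boxtimes> H)
            (pverts (Res G R\<^sub>G) \<times> pverts H \<union> pverts G \<times> pverts (Res H R\<^sub>H)))"
proof -
  have G: "pair_wf_digraph G" and H: "pair_wf_digraph H"
    using assms(1,3) by (simp_all add: pair_graph_def pair_digraph_def pair_fin_digraph_def)
  note GH = pair_wf_digraph_strong_prod[OF G H]
  obtain r where r: "level G R\<^sub>G r \<noteq> {}"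
      "\<And>v. v \<in> pverts G \<Longrightarrow> set_dist G (pverts R\<^sub>G) {v} \<le> enat r"
    using ex_eccentricity[OF assms(1,2,5)] by blast
  obtain s where s: "level H R\<^sub>H s \<noteq> {}"
      "\<And>y. y \<in> pverts H \<Longrightarrow> set_dist H (pverts R\<^sub>H) {y} \<le> enat s"
    using ex_eccentricity[OF assms(3,4,6)] by blast
  let ?A = "level G R\<^sub>G r" and ?B = "level H R\<^sub>H s"
  let ?L = "{(v, y) \<in> pverts G \<times> pverts H.
    max (set_dist G (pverts R\<^sub>G) {v}) (set_dist H (pverts R\<^sub>H) {y}) = enat (max r s)}"
  have Res_G: "Res G R\<^sub>G = induced G ?A" and Res_H: "Res H R\<^sub>H = induced H ?B"
    by (simp_all only: Res_def Greatest_level_eq[OF r] Greatest_level_eq[OF s])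
  have A: "?A \<subseteq> pverts G" and B: "?B \<subseteq> pverts H"
    by (auto simp: level_def)
  have Res_GH: "Res (G \<boxtimes> H) (R\<^sub>G \<boxtimes> R\<^sub>H) = induced (G \<boxtimes> H) ?L"
    by (rule Res_strong_prod[OF G H assms(5,6) r s])
  have dist: "root_dist G R\<^sub>G = enat r" "root_dist H R\<^sub>H = enat s"
    by (simp_all only: root_dist_eq[OF r] root_dist_eq[OF s])
  have "Res (G \<boxtimes> H) (R\<^sub>G \<boxtimes> R\<^sub>H) \<cong>\<^sub>g H \<boxtimes> Res G R\<^sub>G" if "r > s"
  proof -
    \<comment> \<open>As \<open>b\<close> is at most \<open>s < r\<close>, only \<open>a\<close> can
      reach the maximum; the second coordinate is then unrestricted.\<close>
    have "max a b = enat (max r s) \<longleftrightarrow> a = enat r" if "b \<le> enat s" for a b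
      using \<open>r > s\<close> that by (cases a; cases b) (auto simp: max_def)
    then have "?L = ?A \<times> pverts H"
      using s(2) by (auto simp: level_def)
    then show ?thesis
      using strong_prod_commute[OF pair_wf_digraph_induced[OF G] H]
      by (simp add: Res_GH Res_G flip: strong_prod_induced_left[OF H A])
  qed
  moreover have "Res (G \<boxtimes> H) (R\<^sub>G \<boxtimes> R\<^sub>H) \<cong>\<^sub>g G \<boxtimes> Res H R\<^sub>H" if "r < s"
  proof -
    have "max a b = enat (max r s) \<longleftrightarrow> b = enat s" if "a \<le> enat r" for a b
      using \<open>r < s\<close> that by (cases a; cases b) (auto simp: max_def)
    then have "?L = pverts G \<times> ?B"
      using r(2) by (auto simp: level_def)
    \<comment> \<open>The factors are already in the required order, so both sides are equal and
      reflexivity suffices.\<close>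
    then show ?thesis
      using graph_iso_refl[OF pair_wf_digraph_induced[OF GH]]
      by (simp add: Res_GH Res_H strong_prod_induced_right[OF G B])
  qed
  moreover have "Res (G \<boxtimes> H) (R\<^sub>G \<boxtimes> R\<^sub>H) \<cong>\<^sub>g induced (G \<boxtimes> H)
      (pverts (Res G R\<^sub>G) \<times> pverts H \<union> pverts G \<times> pverts (Res H R\<^sub>H))" if "r = s"
  proof -
    \<comment> \<open>Both distances are bounded by the same number, so either coordinate alone can
      attain it; this gives the union.\<close>
    have "max a b = enat (max r s) \<longleftrightarrow> a = enat r \<or> b = enat s"
      if "a \<le> enat r" "b \<le> enat s" for a b
      using \<open>r = s\<close> that by (auto simp: max_def)
    then have "?L = ?A \<times> pverts H \<union> pverts G \<times> ?B"
      using r(2) s(2) by (auto simp: level_def)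
    then have "?L = pverts (Res G R\<^sub>G) \<times> pverts H \<union> pverts G \<times> pverts (Res H R\<^sub>H)"
      by (simp add: Res_G Res_H induced_def)
    then show ?thesis
      using graph_iso_refl[OF pair_wf_digraph_induced[OF GH]] by (simp add: Res_GH)
  qed
  ultimately show ?thesis
    by (simp add: dist)
qed

end
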